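(* For every positive integer $n$, $\limsup_{x\to\infty,\ x\in\mathbb{N}} X(n\cdot x)=e^{\gamma}$.
   Context: For an integer $m\ge 2$, $\sigma(m)$ denotes the sum of the positive divisors of $m$ and $X(m):=\frac{\sigma(m)}{m\ln\ln m}$. $\gamma$ is the Euler–Mascheroni constant. *)

theory Defs
  imports "HOL-Analysis.Analysis"
begin

definition divisor_sum :: "nat \<Rightarrow> nat" where
  "divisor_sum m = (\<Sum>d | d dvd m. d)"

(* Intended for m \<ge> 2; the values at 0 and 1 are junk. *)
definition X :: "nat \<Rightarrow> real" where
  "X m = real (divisor_sum m) / (real m * ln (ln (real m)))"

end

theory Submission
  imports Defs "HOL-Real_Asymp.Real_Asymp" "HOL-Computational_Algebra.Primes"
begin

text \<open>
  The theorem rests on Mertens' third theorem, in the form that the sum of \<open>- ln (1 - 1/p)\<close> over the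
  primes \<open>p \<le> x\<close> is \<open>ln (ln x) + \<gamma> + o(1)\<close>. It is obtained here by a Tauberian comparison with the
  harmonic series: the measure with mass \<open>- ln (1 - 1/p)\<close> at \<open>ln p\<close> and the measure with mass \<open>1/n\<close>
  at \<open>n\<close> both have a Laplace transform \<open>- ln \<delta> + o(1)\<close> as \<open>\<delta>\<close> tends to \<open>0\<close>, the first one because of
  the Euler product and the simple pole of the zeta function. Both distribution functions therefore
  have the same asymptotics, and that of the harmonic series is \<open>ln t + \<gamma> + o(1)\<close>.

  The quotient \<open>\<sigma>(m)/m\<close> is at most the product of \<open>1/(1 - 1/p)\<close> over the primes dividing \<open>m\<close>. Those
  above \<open>ln m\<close> number at most \<open>ln m / ln (ln m)\<close> and contribute a factor \<open>1 + o(1)\<close>, which gives the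
  upper bound. For the lower bound take for \<open>x\<close> the product of \<open>p ^ (2 r)\<close> over the primes
  \<open>p \<le> 2 ^ r\<close>: the exponent makes the geometric sums almost complete, while \<open>ln (ln (n x))\<close> is still
  asymptotic to \<open>ln (2 ^ r)\<close>, even though the number of primes is only bounded by \<open>2 ^ r\<close>.
\<close>

section \<open>A Tauberian comparison\<close>

text \<open>A discrete measure with mass \<open>w n\<close> at the point \<open>l n\<close>. The
  points need be neither distinct nor ordered, and indices of weight 0 serve as padding, so that all
  natural numbers can be used as indices.\<close>

locale log_laplace =
  fixes w l :: "nat \<Rightarrow> real"
  assumes weight_nonneg: "w n \<ge> 0"
    and position_nonneg: "l n \<ge> 0"
    and summable_laplace: "\<delta> > 0 \<Longrightarrow> summable (\<lambda>n. w n * exp (- \<delta> * l n))"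
    and laplace_asymp:
      "((\<lambda>\<delta>. (\<Sum>n. w n * exp (- \<delta> * l n)) + ln \<delta>) \<longlongrightarrow> 0) (at_right 0)"
begin

text \<open>Karamata's substitution \<open>x = exp (- \<delta> * l)\<close> carries the half-line to
  the unit interval: powers of \<open>x\<close> give values of the Laplace transform, and indicator
  functions give values of the distribution function \<open>N\<close>.\<close>

definition T :: "(real \<Rightarrow> real) \<Rightarrow> real \<Rightarrow> real" where
  "T f \<delta> = (\<Sum>n. w n * f (exp (- \<delta> * l n)))"

definition N :: "real \<Rightarrow> real" where
  "N t = (\<Sum>n. if l n \<le> t then w n else 0)"

lemma exp_position_range:
  assumes "\<delta> > 0"
  shows "exp (- \<delta> * l n) \<in> {0..1}"
  using assms position_nonneg[of n] by simp

lemma summable_T: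
  assumes "\<delta> > 0" and "\<And>x. x \<in> {0..1} \<Longrightarrow> \<bar>f x\<bar> \<le> C * x"
  shows "summable (\<lambda>n. w n * f (exp (- \<delta> * l n)))"
proof (rule summable_comparison_test')
  show "summable (\<lambda>n. C * (w n * exp (- \<delta> * l n)))"
    by (intro summable_mult summable_laplace assms)
  show "norm (w n * f (exp (- \<delta> * l n))) \<le> C * (w n * exp (- \<delta> * l n))" for n
    using mult_left_mono[OF assms(2)[OF exp_position_range[OF assms(1), of n]] weight_nonneg[of n]]
    by (simp add: abs_mult weight_nonneg mult_ac)
qed

text \<open>The transform of a power is the Laplace transform at \<open>Suc k * \<delta>\<close>,
  and the limit comes from splitting the logarithm of this product.\<close>

lemma T_power: "((\<lambda>\<delta>. T (\<lambda>x. x ^ Suc k) \<delta> + ln \<delta>) \<longlongrightarrow> - ln (real (Suc k))) (at_right 0)"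
proof -
  let ?F = "\<lambda>\<delta>. (\<Sum>n. w n * exp (- \<delta> * l n)) + ln \<delta>"
  have "filterlim (\<lambda>\<delta>::real. real (Suc k) * \<delta>) (at_right 0) (at_right 0)"
    by real_asymp
  from filterlim_compose[OF laplace_asymp this]
  have "((\<lambda>\<delta>. ?F (real (Suc k) * \<delta>) - ln (real (Suc k))) \<longlongrightarrow> 0 - ln (real (Suc k))) (at_right 0)"
    by (intro tendsto_intros)
  moreover have "eventually (\<lambda>\<delta>. ?F (real (Suc k) * \<delta>) - ln (real (Suc k)) =
      T (\<lambda>x. x ^ Suc k) \<delta> + ln \<delta>) (at_right 0)"
    using eventually_at_right_less[of "0::real"]
  proof eventually_elim
    case (elim \<delta>)
    have "exp (- \<delta> * l n) ^ Suc k = exp (- (real (Suc k) * \<delta>) * l n)" for n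
      by (subst exp_of_nat_mult [symmetric]) (simp add: mult_ac)
    then show ?case using elim unfolding T_def by (simp add: ln_mult_pos del: power_Suc of_nat_Suc)
  qed
  ultimately show ?thesis by (simp add: tendsto_cong del: power_Suc)
qed

text \<open>Neither the growth term nor the limit involves \<open>w\<close> and \<open>l\<close>;
  this is what lets two measures be compared. The factor \<open>x\<close> excludes a constant term,
  whose transform would be the total mass.\<close>

lemma T_polynomial:
  "((\<lambda>\<delta>. T (\<lambda>x. x * (\<Sum>i\<le>d. a i * x ^ i)) \<delta> + (\<Sum>i\<le>d. a i) * ln \<delta>)
      \<longlongrightarrow> - (\<Sum>i\<le>d. a i * ln (real (Suc i)))) (at_right 0)"
proof -
  have "((\<lambda>\<delta>. \<Sum>i\<le>d. a i * (T (\<lambda>x. x ^ Suc i) \<delta> + ln \<delta>))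
      \<longlongrightarrow> (\<Sum>i\<le>d. a i * (- ln (real (Suc i))))) (at_right 0)"
    by (intro tendsto_sum tendsto_mult tendsto_const T_power)
  moreover have "eventually (\<lambda>\<delta>. (\<Sum>i\<le>d. a i * (T (\<lambda>x. x ^ Suc i) \<delta> + ln \<delta>)) =
     T (\<lambda>x. x * (\<Sum>i\<le>d. a i * x ^ i)) \<delta> + (\<Sum>i\<le>d. a i) * ln \<delta>) (at_right 0)"
    using eventually_at_right_less[of "0::real"]
  proof eventually_elim
    case (elim \<delta>)
    have summ: "summable (\<lambda>n. w n * exp (- \<delta> * l n) ^ Suc i)" for i
      using elim
      by (intro summable_T[where f = "\<lambda>x. x ^ Suc i" and C = 1])
        (auto simp: power_le_one mult_left_le)
    have "T (\<lambda>x. x * (\<Sum>i\<le>d. a i * x ^ i)) \<delta> =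
        (\<Sum>n. \<Sum>i\<le>d. a i * (w n * exp (- \<delta> * l n) ^ Suc i))"
      unfolding T_def by (simp add: sum_distrib_left mult_ac)
    also have "\<dots> = (\<Sum>i\<le>d. \<Sum>n. a i * (w n * exp (- \<delta> * l n) ^ Suc i))"
      by (intro suminf_sum summable_mult summ)
    also have "\<dots> = (\<Sum>i\<le>d. a i * T (\<lambda>x. x ^ Suc i) \<delta>)"
      unfolding T_def by (intro sum.cong refl suminf_mult summ)
    finally show ?case
      by (simp add: sum_distrib_right sum.distrib distrib_left del: power_Suc)
  qed
  ultimately show ?thesis by (simp add: tendsto_cong sum_negf del: power_Suc)
qed

text \<open>The coefficients 1 and -1 add up to 0, so the divergent \<open>ln \<delta>\<close>
  cancels.\<close>

lemma T_x_one_minus_x: "((\<lambda>\<delta>. T (\<lambda>x. x * (1 - x)) \<delta>) \<longlongrightarrow> ln 2) (at_right 0)"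
  using T_polynomial[of "\<lambda>i. if i = 0 then 1 else -1" 1] by (simp add: algebra_simps)

text \<open>Approximation errors are measured against \<open>x * (1 - x)\<close>, whose transform
  stays bounded. Measured against \<open>x\<close> alone they would be multiplied by a transform
  growing like \<open>- ln \<delta>\<close>.\<close>

lemma T_diff_le:
  assumes "\<delta> > 0"
    and f: "\<And>x. x \<in> {0..1} \<Longrightarrow> \<bar>f x\<bar> \<le> C * x" and g: "\<And>x. x \<in> {0..1} \<Longrightarrow> \<bar>g x\<bar> \<le> D * x"
    and close: "\<And>x. x \<in> {0..1} \<Longrightarrow> \<bar>f x - g x\<bar> \<le> \<eta> * (x * (1 - x))"
  shows "\<bar>T f \<delta> - T g \<delta>\<bar> \<le> \<eta> * T (\<lambda>x. x * (1 - x)) \<delta>"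
proof -
  let ?e = "\<lambda>n. exp (- \<delta> * l n)"
  have s: "summable (\<lambda>n. w n * (?e n * (1 - ?e n)))"
    by (intro summable_T[where f = "\<lambda>x. x * (1 - x)" and C = 1] assms(1))
      (auto simp: abs_mult mult_left_le)
  have sd: "summable (\<lambda>n. w n * f (?e n) - w n * g (?e n))"
    by (intro summable_diff summable_T[OF assms(1) f] summable_T[OF assms(1) g])
  have "T f \<delta> - T g \<delta> = (\<Sum>n. w n * f (?e n) - w n * g (?e n))"
    unfolding T_def
    by (intro suminf_diff summable_T[OF assms(1) f] summable_T[OF assms(1) g])
  also have "norm \<dots> \<le> (\<Sum>n. \<eta> * (w n * (?e n * (1 - ?e n))))"
  proof (rule norm_suminf_le)
    fix n
    have "w n * \<bar>f (?e n) - g (?e n)\<bar> \<le> w n * (\<eta> * (?e n * (1 - ?e n)))"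
      by (intro mult_left_mono close exp_position_range assms(1) weight_nonneg)
    then show "norm (w n * f (?e n) - w n * g (?e n)) \<le> \<eta> * (w n * (?e n * (1 - ?e n)))"
      by (simp add: right_diff_distrib [symmetric] abs_mult weight_nonneg mult_ac)
  qed (intro summable_mult s)
  also have "\<dots> = \<eta> * T (\<lambda>x. x * (1 - x)) \<delta>"
    unfolding T_def by (intro suminf_mult s)
  finally show ?thesis by simp
qed

lemma summable_N: "summable (\<lambda>n. if l n \<le> t then w n else 0)"
proof (rule summable_comparison_test')
  show "summable (\<lambda>n. exp t * (w n * exp (- 1 * l n)))"
    by (intro summable_mult summable_laplace) simp
  show "norm (if l n \<le> t then w n else 0) \<le> exp t * (w n * exp (- 1 * l n))" for n
  proof -
    have "l n \<le> t \<Longrightarrow> w n * 1 \<le> w n * exp (t - l n)"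
      by (intro mult_left_mono weight_nonneg) simp
    then show ?thesis using weight_nonneg[of n] by (auto simp: exp_diff exp_minus field_simps)
  qed
qed

text \<open>The point \<open>l n\<close> is at most \<open>1 / \<delta>\<close> exactly when
  \<open>exp (- \<delta> * l n)\<close> is at least \<open>exp (-1)\<close>, and \<open>f\<close>
  dominates the indicator of that range. \<open>T_le_N\<close> is the mirror image, with
  \<open>f\<close> below the indicator of \<open>{exp (-c)..1}\<close>.\<close>

lemma N_le_T:
  assumes "\<delta> > 0" and f: "\<And>x. x \<in> {0..1} \<Longrightarrow> \<bar>f x\<bar> \<le> C * x"
    and "\<And>x. x \<in> {0..1} \<Longrightarrow> f x \<ge> 0" and "\<And>x. x \<in> {exp (-1)..1} \<Longrightarrow> f x = 1"
  shows "N (1 / \<delta>) \<le> T f \<delta>"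
proof -
  have le: "(if l n \<le> 1 / \<delta> then w n else 0) \<le> w n * f (exp (- \<delta> * l n))" for n
    using assms(4)[of "exp (- \<delta> * l n)"] assms(3)[OF exp_position_range[OF assms(1), of n]]
      weight_nonneg[of n] position_nonneg[of n] assms(1)
    by (auto simp: field_simps)
  show ?thesis
    unfolding N_def T_def by (intro suminf_le le summable_N summable_T[OF assms(1) f])
qed

lemma T_le_N:
  assumes "\<delta> > 0" and f: "\<And>x. x \<in> {0..1} \<Longrightarrow> \<bar>f x\<bar> \<le> C * x"
    and "\<And>x. x \<in> {0..1} \<Longrightarrow> f x \<le> 1" and "\<And>x. x \<in> {0..<exp (-c)} \<Longrightarrow> f x = 0"
  shows "T f \<delta> \<le> N (c / \<delta>)"
proof -
  have le: "w n * f (exp (- \<delta> * l n)) \<le> (if l n \<le> c / \<delta> then w n else 0)" for n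
    using assms(4)[of "exp (- \<delta> * l n)"]
      mult_left_mono[OF assms(3)[OF exp_position_range[OF assms(1), of n]] weight_nonneg[of n]]
      position_nonneg[of n] assms(1)
    by (auto simp: field_simps)
  show ?thesis
    unfolding N_def T_def by (intro suminf_le le summable_N summable_T[OF assms(1) f])
qed

end

text \<open>Karamata's method: the difference of the two transforms vanishes on polynomials divisible by
  \<open>x\<close>, and both transforms of \<open>x (1 - x)\<close> stay bounded, so by Weierstrass approximation of \<open>\<phi>\<close> the
  difference vanishes on \<open>x + x (1 - x) \<phi>(x)\<close> as well.\<close>

lemma T_compare:
  assumes "log_laplace w l" "log_laplace v m" and cont: "continuous_on {0..1} \<phi>"
  shows "((\<lambda>\<delta>. log_laplace.T w l (\<lambda>x. x + x * (1 - x) * \<phi> x) \<delta>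
      - log_laplace.T v m (\<lambda>x. x + x * (1 - x) * \<phi> x) \<delta>) \<longlongrightarrow> 0) (at_right 0)"
proof (rule tendstoI)
  interpret A: log_laplace w l by fact
  interpret B: log_laplace v m by fact
  let ?f = "\<lambda>x. x + x * (1 - x) * \<phi> x"
  fix \<epsilon> :: real assume "\<epsilon> > 0"
  \<comment> \<open>Each of the two measures contributes an approximation error of at most
    \<open>\<eta>\<close>; the remaining \<open>\<epsilon> / 2\<close> is for the polynomial
    itself.\<close>
  define \<eta> where "\<eta> = \<epsilon> / 4"
  have "\<eta> > 0" using \<open>\<epsilon> > 0\<close> by (simp add: \<eta>_def)
  obtain q where q: "real_polynomial_function q" "\<And>x. x \<in> {0..1} \<Longrightarrow> \<bar>\<phi> x - q x\<bar> < \<eta>"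
    using Stone_Weierstrass_real_polynomial_function[OF compact_Icc cont \<open>\<eta> > 0\<close>] by metis
  \<comment> \<open>Multiplied by \<open>x\<close>, this polynomial becomes
    \<open>x + x * (1 - x) * q x\<close>, the shape that \<open>T_polynomial\<close>
    requires.\<close>
  have "real_polynomial_function (\<lambda>x. 1 + (1 - x) * q x)"
    by (intro real_polynomial_function.intros(3)[OF real_polynomial_function.intros(2)]
        real_polynomial_function.intros(4)[OF real_polynomial_function_diff q(1)]
        real_polynomial_function.intros(2)
        real_polynomial_function.intros(1)[OF bounded_linear_ident])
  then obtain a d where ad: "(\<lambda>x. 1 + (1 - x) * q x) = (\<lambda>x. \<Sum>i\<le>d. a i * x ^ i)"
    unfolding real_polynomial_function_iff_sum by blast
  define g where "g = (\<lambda>x. x * (\<Sum>i\<le>d. a i * x ^ i))"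
  have g_eq: "g x = x + x * (1 - x) * q x" for x
    unfolding g_def fun_cong[OF ad, symmetric] by (simp add: algebra_simps)
  have bound: "\<exists>C. \<forall>x\<in>{0..1}. \<bar>x + x * (1 - x) * \<psi> x\<bar> \<le> C * x"
    if c: "continuous_on {0..1} \<psi>" for \<psi> :: "real \<Rightarrow> real"
  proof -
    have "continuous_on {0..1} (\<lambda>x. 1 + (1 - x) * \<psi> x)" by (intro continuous_intros c)
    then have "bounded ((\<lambda>x. 1 + (1 - x) * \<psi> x) ` {0..1})"
      by (intro compact_imp_bounded compact_continuous_image compact_Icc)
    then obtain C where C: "\<forall>x\<in>{0..1}. \<bar>1 + (1 - x) * \<psi> x\<bar> \<le> C"
      by (auto simp: bounded_iff)
    have "\<bar>x + x * (1 - x) * \<psi> x\<bar> \<le> C * x" if "x \<in> {0..1}" for x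
    proof -
      have "x + x * (1 - x) * \<psi> x = (1 + (1 - x) * \<psi> x) * x"
        by (simp add: algebra_simps)
      then have "\<bar>x + x * (1 - x) * \<psi> x\<bar> = \<bar>1 + (1 - x) * \<psi> x\<bar> * x"
        using that by (simp add: abs_mult)
      then show ?thesis using mult_right_mono[OF bspec[OF C that], of x] that by simp
    qed
    then show ?thesis by blast
  qed
  have "continuous_on {0..1} q"
    using q(1) by (simp add: continuous_on_polymonial_function real_polynomial_function_eq)
  from bound[OF this] obtain D where D: "\<And>x. x \<in> {0..1} \<Longrightarrow> \<bar>g x\<bar> \<le> D * x"
    unfolding g_eq by blast
  obtain C where C: "\<And>x. x \<in> {0..1} \<Longrightarrow> \<bar>?f x\<bar> \<le> C * x"
    using bound[OF cont] by blast
  have close: "\<bar>?f x - g x\<bar> \<le> \<eta> * (x * (1 - x))" if "x \<in> {0..1}" for x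
  proof -
    have "\<bar>?f x - g x\<bar> = \<bar>x * (1 - x) * (\<phi> x - q x)\<bar>"
      by (simp add: g_eq right_diff_distrib)
    also have "\<dots> = x * (1 - x) * \<bar>\<phi> x - q x\<bar>"
      using that by (simp add: abs_mult)
    also have "\<dots> \<le> x * (1 - x) * \<eta>"
      using that q(2)[OF that] by (intro mult_left_mono) auto
    finally show ?thesis by (simp add: mult_ac)
  qed
  have "((\<lambda>\<delta>. A.T g \<delta> - B.T g \<delta>) \<longlongrightarrow> 0) (at_right 0)"
    using tendsto_diff[OF A.T_polynomial[of a d] B.T_polynomial[of a d]]
    by (simp add: g_def)
  from tendstoD[OF this half_gt_zero[OF \<open>\<epsilon> > 0\<close>]]
  have "eventually (\<lambda>\<delta>. \<bar>A.T g \<delta> - B.T g \<delta>\<bar> < \<epsilon> / 2) (at_right 0)"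
    by (simp add: dist_real_def)
  moreover have "ln 2 < (1::real)" using ln_2_less_1 by simp
  then have "eventually (\<lambda>\<delta>. A.T (\<lambda>x. x * (1 - x)) \<delta> < 1) (at_right 0)"
    "eventually (\<lambda>\<delta>. B.T (\<lambda>x. x * (1 - x)) \<delta> < 1) (at_right 0)"
    using order_tendstoD(2) A.T_x_one_minus_x B.T_x_one_minus_x by blast+
  ultimately show "eventually (\<lambda>\<delta>. dist (A.T ?f \<delta> - B.T ?f \<delta>) 0 < \<epsilon>) (at_right 0)"
    using eventually_at_right_less[of "0::real"]
  proof eventually_elim
    case (elim \<delta>)
    have "\<bar>A.T ?f \<delta> - A.T g \<delta>\<bar> \<le> \<eta> * A.T (\<lambda>x. x * (1 - x)) \<delta>"
      by (rule A.T_diff_le[OF elim(4) C D close])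
    also have "\<dots> \<le> \<eta> * 1" using elim \<open>\<eta> > 0\<close> by (intro mult_left_mono) auto
    finally have 1: "\<bar>A.T ?f \<delta> - A.T g \<delta>\<bar> \<le> \<epsilon> / 4" by (simp add: \<eta>_def)
    have "\<bar>B.T ?f \<delta> - B.T g \<delta>\<bar> \<le> \<eta> * B.T (\<lambda>x. x * (1 - x)) \<delta>"
      by (rule B.T_diff_le[OF elim(4) C D close])
    also have "\<dots> \<le> \<eta> * 1" using elim \<open>\<eta> > 0\<close> by (intro mult_left_mono) auto
    finally have "\<bar>B.T ?f \<delta> - B.T g \<delta>\<bar> \<le> \<epsilon> / 4" by (simp add: \<eta>_def)
    with 1 elim(1) show ?case unfolding dist_real_def by linarith
  qed
qed

text \<open>A continuous \<open>h\<close> fits between the indicators of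
  \<open>{exp (-1)..1}\<close> and \<open>{exp (-c)..1}\<close>, so its transform lies above
  \<open>N (1 / \<delta>)\<close> and below \<open>N (c / \<delta>)\<close>. The dilation by
  \<open>c\<close> is the price of continuity; against a logarithm it costs only
  \<open>ln c\<close>.\<close>

lemma N_compare:
  assumes A: "log_laplace w l" and B: "log_laplace v m" and "c > 1" "\<epsilon> > 0"
  shows "eventually (\<lambda>t. log_laplace.N w l t \<le> log_laplace.N v m (c * t) + \<epsilon>) at_top"
proof -
  interpret A: log_laplace w l by fact
  interpret B: log_laplace v m by fact
  define a b where "a = exp (- c)" and "b = exp (-1 :: real)"
  have ab: "0 < a" "a < b" "b < 1" using \<open>c > 1\<close> by (auto simp: a_def b_def)
  define h where "h = (\<lambda>x. max 0 (min 1 ((x - a) / (b - a))))"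
  \<comment> \<open>\<open>\<phi>\<close> is \<open>(h x - x) / (x (1 - x)) = h x / x - (1 - h x) / (1 - x)\<close> without its removable
    singularities: \<open>h\<close> vanishes below \<open>a\<close> and is \<open>1\<close> above \<open>b\<close>.\<close>
  define \<phi> where "\<phi> = (\<lambda>x. h x / max x a - (1 - h x) / max (1 - x) (1 - b))"
  have h0: "h x = 0" if "x \<le> a" for x
    using that ab by (simp add: h_def max_def min_def field_simps)
  have h1: "h x = 1" if "x \<ge> b" for x
    using that ab by (simp add: h_def max_def min_def field_simps)
  have h_range: "0 \<le> h x" "h x \<le> 1" for x by (auto simp: h_def)
  have cont_h: "continuous_on S h" for S
    unfolding h_def using ab by (intro continuous_intros) auto
  have "continuous_on {0..1} \<phi>"
    unfolding \<phi>_def using ab by (intro continuous_intros cont_h) (auto simp: max_def)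
  from T_compare[OF A B this]
  have lim: "((\<lambda>\<delta>. A.T (\<lambda>x. x + x * (1 - x) * \<phi> x) \<delta> - B.T (\<lambda>x. x + x * (1 - x) * \<phi> x) \<delta>)
      \<longlongrightarrow> 0) (at_right 0)" .
  have "x + x * (1 - x) * \<phi> x = h x" for x
  proof -
    have 1: "x * (h x / max x a) = h x"
      using ab h0[of x] by (auto simp: max_def)
    have 2: "(1 - x) * ((1 - h x) / max (1 - x) (1 - b)) = 1 - h x"
      using ab h1[of x] by (auto simp: max_def)
    have "x * (1 - x) * \<phi> x = (1 - x) * (x * (h x / max x a))
        - x * ((1 - x) * ((1 - h x) / max (1 - x) (1 - b)))"
      unfolding \<phi>_def by (subst right_diff_distrib) (simp only: mult_ac)
    also have "\<dots> = (1 - x) * h x - x * (1 - h x)" unfolding 1 2 ..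
    finally show ?thesis by (simp add: algebra_simps)
  qed
  with lim have "((\<lambda>\<delta>. A.T h \<delta> - B.T h \<delta>) \<longlongrightarrow> 0) (at_right 0)" by simp
  then have "eventually (\<lambda>\<delta>. A.T h \<delta> - B.T h \<delta> < \<epsilon>) (at_right 0)"
    using \<open>\<epsilon> > 0\<close> by (rule order_tendstoD(2))
  then have "eventually (\<lambda>\<delta>. A.N (1 / \<delta>) \<le> B.N (c / \<delta>) + \<epsilon>) (at_right 0)"
    using eventually_at_right_less[of "0::real"]
  proof eventually_elim
    case (elim \<delta>)
    have C: "\<bar>h x\<bar> \<le> inverse a * x" if "x \<in> {0..1}" for x
    proof (cases "x \<le> a")
      case False
      then have "1 \<le> inverse a * x" using ab by (simp add: field_simps)
      then show ?thesis using h_range[of x] by auto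
    qed (use that ab h0 in auto)
    have "A.N (1 / \<delta>) \<le> A.T h \<delta>"
      using h1 by (intro A.N_le_T[OF elim(2) C] h_range) (auto simp: b_def)
    moreover have "B.T h \<delta> \<le> B.N (c / \<delta>)"
      using h0 by (intro B.T_le_N[OF elim(2) C] h_range) (auto simp: a_def)
    ultimately show ?case using elim by simp
  qed
  then have "eventually (\<lambda>t. A.N (1 / inverse t) \<le> B.N (c / inverse t) + \<epsilon>) at_top"
    using filterlim_inverse_at_right_top unfolding filterlim_iff by blast
  then show ?thesis by (simp add: divide_inverse)
qed

section \<open>Mertens' third theorem\<close>

definition zeta :: "real \<Rightarrow> real" where
  "zeta s = (\<Sum>n. real n powr (- s))"

lemma summable_zeta: "s > 1 \<Longrightarrow> summable (\<lambda>n. real n powr (- s))"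
  by (simp add: summable_real_powr_iff)

text \<open>The mean value theorem for \<open>z powr (- \<delta>)\<close> on an interval of length
  1, whose derivative is monotone.\<close>

lemma powr_telescope_bounds:
  fixes x \<delta> :: real
  assumes "x > 0" "\<delta> > 0"
  shows "\<delta> * (x + 1) powr (- (1 + \<delta>)) \<le> x powr (- \<delta>) - (x + 1) powr (- \<delta>)"
    and "x powr (- \<delta>) - (x + 1) powr (- \<delta>) \<le> \<delta> * x powr (- (1 + \<delta>))"
proof -
  have "\<exists>z>x. z < x + 1 \<and> (x + 1) powr (- \<delta>) - x powr (- \<delta>)
      = (x + 1 - x) * (- \<delta> * z powr (- (1 + \<delta>)))"
  proof (rule MVT2)
    fix z assume "x \<le> z" "z \<le> x + 1"
    have eq: "- (1 + \<delta>) = - \<delta> - 1" by simp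
    show "((\<lambda>z. z powr (- \<delta>)) has_real_derivative - \<delta> * z powr (- (1 + \<delta>))) (at z)"
      unfolding eq using assms \<open>x \<le> z\<close> by (auto intro!: derivative_eq_intros)
  qed simp
  then obtain z where z: "x < z" "z < x + 1"
    "x powr (- \<delta>) - (x + 1) powr (- \<delta>) = \<delta> * z powr (- (1 + \<delta>))"
    by (auto simp: algebra_simps)
  have "(x + 1) powr (- (1 + \<delta>)) \<le> z powr (- (1 + \<delta>))"
    "z powr (- (1 + \<delta>)) \<le> x powr (- (1 + \<delta>))"
    using assms z by (auto intro!: powr_mono2')
  then show "\<delta> * (x + 1) powr (- (1 + \<delta>)) \<le> x powr (- \<delta>) - (x + 1) powr (- \<delta>)"
    "x powr (- \<delta>) - (x + 1) powr (- \<delta>) \<le> \<delta> * x powr (- (1 + \<delta>))"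
    unfolding z(3) using assms by (auto intro!: mult_left_mono)
qed

text \<open>The differences of consecutive values of \<open>n powr (- \<delta>)\<close> telescope to
  1 and are squeezed between consecutive terms of the zeta series times \<open>\<delta>\<close>. In
  the upper bound the term at 1 is split off, which accounts for the extra
  \<open>\<delta>\<close>.\<close>

lemma zeta_bounds:
  assumes "\<delta> > 0"
  shows "1 \<le> \<delta> * zeta (1 + \<delta>)" "\<delta> * zeta (1 + \<delta>) \<le> 1 + \<delta>"
proof -
  let ?f = "\<lambda>n. real n powr (- (1 + \<delta>))"
  let ?g = "\<lambda>n. real (Suc n) powr (- \<delta>)"
  have s: "summable ?f" using assms by (intro summable_zeta) simp
  then have s1: "summable (\<lambda>n. ?f (Suc n))" and s2: "summable (\<lambda>n. ?f (Suc (Suc n)))"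
    using summable_ignore_initial_segment[of ?f 1] summable_ignore_initial_segment[of ?f 2] by simp_all
  have "?g \<longlonglongrightarrow> 0" using assms by real_asymp
  from telescope_sums'[OF this] have tel: "(\<lambda>n. ?g n - ?g (Suc n)) sums 1" by simp
  \<comment> \<open>The term at index 0 vanishes because \<open>0 powr a\<close> is 0.\<close>
  have z1: "zeta (1 + \<delta>) = (\<Sum>n. ?f (Suc n))"
    unfolding zeta_def using suminf_split_head[OF s] by simp
  have z2: "(\<Sum>n. ?f (Suc n)) = 1 + (\<Sum>n. ?f (Suc (Suc n)))"
    using suminf_split_head[OF s1] by simp
  have "(\<Sum>n. ?g n - ?g (Suc n)) \<le> (\<Sum>n. \<delta> * ?f (Suc n))"
    using powr_telescope_bounds(2)[OF _ assms, of "real (Suc n)" for n]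
    by (intro suminf_le sums_summable[OF tel] summable_mult s1) (simp add: add_ac)
  then show "1 \<le> \<delta> * zeta (1 + \<delta>)"
    unfolding z1 suminf_mult[OF s1] sums_unique[OF tel, symmetric] .
  have "(\<Sum>n. \<delta> * ?f (Suc (Suc n))) \<le> (\<Sum>n. ?g n - ?g (Suc n))"
    using powr_telescope_bounds(1)[OF _ assms, of "real (Suc n)" for n]
    by (intro suminf_le sums_summable[OF tel] summable_mult s2) (simp add: add_ac)
  then have "\<delta> * (\<Sum>n. ?f (Suc (Suc n))) \<le> 1"
    unfolding suminf_mult[OF s2] sums_unique[OF tel, symmetric] .
  then show "\<delta> * zeta (1 + \<delta>) \<le> 1 + \<delta>" unfolding z1 z2 by (simp add: algebra_simps)
qed

lemma zeta_pos: "s > 1 \<Longrightarrow> zeta s > 0"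
  using zeta_bounds(1)[of "s - 1"] by (smt (verit) mult_nonneg_nonpos)

lemma ln_zeta_asymp: "((\<lambda>\<delta>. ln (zeta (1 + \<delta>)) + ln \<delta>) \<longlongrightarrow> 0) (at_right 0)"
proof -
  have "((\<lambda>\<delta>. \<delta> * zeta (1 + \<delta>)) \<longlongrightarrow> 1) (at_right 0)"
  proof (rule tendsto_sandwich)
    show "eventually (\<lambda>\<delta>. 1 \<le> \<delta> * zeta (1 + \<delta>)) (at_right 0)"
      "eventually (\<lambda>\<delta>. \<delta> * zeta (1 + \<delta>) \<le> 1 + \<delta>) (at_right 0)"
      using eventually_at_right_less[of "0::real"] by (eventually_elim, simp add: zeta_bounds)+
    show "((\<lambda>\<delta>. 1 + \<delta>) \<longlongrightarrow> (1::real)) (at_right 0)" by real_asymp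
  qed simp
  then have "((\<lambda>\<delta>. ln (\<delta> * zeta (1 + \<delta>))) \<longlongrightarrow> ln 1) (at_right 0)"
    by (intro tendsto_ln) auto
  moreover have "eventually (\<lambda>\<delta>. ln (\<delta> * zeta (1 + \<delta>)) = ln (zeta (1 + \<delta>)) + ln \<delta>) (at_right 0)"
    using eventually_at_right_less[of "0::real"]
    by eventually_elim (simp add: ln_mult_pos zeta_pos)
  ultimately show ?thesis by (simp add: tendsto_cong)
qed

section \<open>The Euler product\<close>

text \<open>Sieving by one more prime \<open>p\<close> removes the multiples of \<open>p\<close>. As
  \<open>p\<close> is coprime to the earlier primes, these form the \<open>p\<close>-fold dilate of
  the sieved set and carry the fraction \<open>p powr (- s)\<close> of its sum.\<close>

lemma infsum_sieve:
  assumes "s > 1" "finite P" "\<And>p. p \<in> P \<Longrightarrow> prime p"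
  shows "infsum (\<lambda>n. real n powr (- s)) {n. \<forall>p\<in>P. \<not> p dvd n} =
    zeta s * (\<Prod>p\<in>P. 1 - real p powr (- s))"
  using assms(2,3)
proof (induction P rule: finite_induct)
  case empty
  have "((\<lambda>n. real n powr (- s)) has_sum zeta s) UNIV"
    unfolding zeta_def using summable_zeta[OF assms(1)]
    by (intro sums_nonneg_imp_has_sum) auto
  then show ?case by (simp add: infsumI)
next
  case (insert p P)
  let ?f = "\<lambda>n. real n powr (- s)"
  let ?C = "\<lambda>P. {n. \<forall>p\<in>P. \<not> p dvd n} :: nat set"
  have p: "prime p" and P: "\<And>q. q \<in> P \<Longrightarrow> prime q" using insert by auto
  have "?f summable_on UNIV"
    using summable_zeta[OF assms(1)] by (intro norm_summable_imp_summable_on) simp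
  then have summ: "?f summable_on A" for A by (rule summable_on_subset_banach) simp
  have mem: "p * n \<in> ?C P \<longleftrightarrow> n \<in> ?C P" for n
    using insert.hyps P p by (auto simp: prime_dvd_mult_iff dest: primes_dvd_imp_eq)
  have split: "?C P = ?C (insert p P) \<union> (\<lambda>n. p * n) ` ?C P"
  proof (rule set_eqI)
    fix n
    show "n \<in> ?C P \<longleftrightarrow> n \<in> ?C (insert p P) \<union> (\<lambda>n. p * n) ` ?C P"
    proof (cases "p dvd n")
      case True
      then obtain k where "n = p * k" by (elim dvdE)
      with mem[of k] p show ?thesis by (auto simp: prime_gt_0_nat)
    qed auto
  qed
  have "infsum ?f (?C P) = infsum ?f (?C (insert p P)) + infsum ?f ((\<lambda>n. p * n) ` ?C P)"
    by (subst split, rule infsum_Un_disjoint) (auto intro: summ)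
  also have "infsum ?f ((\<lambda>n. p * n) ` ?C P) = infsum (\<lambda>n. real p powr (- s) * ?f n) (?C P)"
    using p by (subst infsum_reindex) (auto simp: inj_on_def prime_gt_0_nat powr_mult o_def)
  also have "\<dots> = real p powr (- s) * infsum ?f (?C P)"
    by (rule infsum_cmult_right) (rule summ)
  finally have "infsum ?f (?C (insert p P)) = infsum ?f (?C P) * (1 - real p powr (- s))"
    by (simp add: algebra_simps)
  also have "infsum ?f (?C P) = zeta s * (\<Prod>p\<in>P. 1 - real p powr (- s))"
    using insert.IH P by blast
  finally show ?case using insert.hyps by (simp add: mult_ac)
qed

text \<open>After sieving by the primes below \<open>N\<close>, only 1, numbers from
  \<open>N\<close> on and possibly the weightless 0 are left. The partial product
  \<open>?R N\<close> therefore lies between 1 and 1 plus a tail of the convergent zeta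
  series.\<close>

lemma euler_product:
  assumes "s > 1"
  shows "(\<lambda>n. if prime n then - ln (1 - real n powr (- s)) else 0) sums ln (zeta s)"
proof -
  let ?f = "\<lambda>n. real n powr (- s)"
  let ?P = "\<lambda>N. {p. prime p \<and> p < N}"
  let ?C = "\<lambda>N. {n. \<forall>p\<in>?P N. \<not> p dvd n} :: nat set"
  let ?R = "\<lambda>N. zeta s * (\<Prod>p\<in>?P N. 1 - ?f p)"
  have "?f summable_on UNIV"
    using summable_zeta[OF assms(1)] by (intro norm_summable_imp_summable_on) simp
  then have summ: "?f summable_on A" for A by (rule summable_on_subset_banach) simp
  have has: "(?f has_sum zeta s) UNIV"
    unfolding zeta_def using summable_zeta[OF assms(1)]
    by (intro sums_nonneg_imp_has_sum) auto
  have R: "?R N = infsum ?f (?C N)" for N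
    by (rule infsum_sieve[OF assms, symmetric]) auto
  have lower: "1 \<le> ?R N" for N
  proof -
    have "infsum ?f {1} \<le> infsum ?f (?C N)"
      by (rule infsum_mono2[OF summ summ]) auto
    then show ?thesis unfolding R by simp
  qed
  have upper: "?R N \<le> 1 + (zeta s - (\<Sum>n<N. ?f n))" for N
  proof -
    have "infsum ?f (?C N) \<le> infsum ?f ({1} \<union> {N..})"
    proof (rule infsum_mono_neutral[OF summ summ])
      fix n assume n: "n \<in> ?C N - ({1} \<union> {N..})"
      show "?f n \<le> 0"
      \<comment> \<open>For \<open>N\<close> equal to 1 or 2 there are no primes to sieve by, so 0
        survives; its weight is 0.\<close>
      proof (cases "n = 0")
        case False
        with n obtain p where "prime p" "p dvd n" using prime_factor_nat[of n] by auto
        moreover from this False n have "p < N" using dvd_imp_le[of p n] by auto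
        ultimately show ?thesis using n by auto
      qed simp
    qed auto
    also have "\<dots> \<le> infsum ?f {1} + infsum ?f {N..}"
    \<comment> \<open>For \<open>N \<le> 1\<close> the two sets overlap and only the inequality
      holds.\<close>
    proof (cases "1 \<in> {N..}")
      case True
      then show ?thesis by (simp add: insert_absorb)
    next
      case False
      then show ?thesis by (subst infsum_Un_disjoint) (auto intro: summ)
    qed
    also have "infsum ?f {N..} = zeta s - (\<Sum>n<N. ?f n)"
    proof -
      have "infsum ?f ({..<N} \<union> {N..}) = infsum ?f {..<N} + infsum ?f {N..}"
        by (rule infsum_Un_disjoint) (auto intro: summ)
      moreover have "{..<N} \<union> {N..} = UNIV" by auto
      ultimately show ?thesis using infsumI[OF has] by simp
    qed
    finally show ?thesis unfolding R by simp
  qed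
  have "(\<lambda>N. 1 + (zeta s - (\<Sum>n<N. ?f n))) \<longlonglongrightarrow> 1 + (zeta s - zeta s)"
    unfolding zeta_def by (intro tendsto_intros summable_LIMSEQ summable_zeta assms)
  then have "?R \<longlonglongrightarrow> 1"
    by (intro tendsto_sandwich[OF _ _ tendsto_const, of 1 ?R]) (auto intro: lower upper always_eventually)
  then have "(\<lambda>N. ln (zeta s) - ln (?R N)) \<longlonglongrightarrow> ln (zeta s) - ln 1"
    by (intro tendsto_intros) auto
  moreover have "ln (zeta s) - ln (?R N) = (\<Sum>n<N. if prime n then - ln (1 - ?f n) else 0)" for N
  proof -
    have pos: "1 - ?f p > 0" if "prime p" for p
      using that assms prime_gt_1_nat[OF that] by (auto simp: powr_minus field_simps intro: gr_one_powr)
    have "ln (\<Prod>p\<in>?P N. 1 - ?f p) = (\<Sum>p\<in>?P N. ln (1 - ?f p))"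
      using pos by (intro ln_prod) (auto simp: less_imp_neq[symmetric])
    also have "\<dots> = (\<Sum>n<N. if prime n then ln (1 - ?f n) else 0)"
      by (rule sum.mono_neutral_cong_left) auto
    also have "\<dots> = - (\<Sum>n<N. if prime n then - ln (1 - ?f n) else 0)"
      by (subst sum_negf [symmetric]) (auto intro: sum.cong)
    finally show ?thesis
      using zeta_pos[OF assms] pos by (subst ln_mult_pos) (auto intro: prod_pos)
  qed
  ultimately show ?thesis unfolding sums_def by simp
qed

section \<open>The two measures to be compared\<close>

lemma finite_primes_le: "finite {p. prime p \<and> real p \<le> x}"
  by (rule finite_subset[of _ "{..nat \<lfloor>x\<rfloor>}"]) (auto simp: le_nat_floor)

lemma one_over_prime:
  assumes "prime (p :: nat)"
  shows "0 < 1 / real p" "1 / real p \<le> 1 / 2"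
  using prime_ge_2_nat[OF assms] by (auto simp: field_simps)

lemma abs_ln_one_minus_add_le:
  fixes x :: real
  assumes "0 \<le> x" "x \<le> 1 / 2"
  shows "\<bar>ln (1 - x) + x\<bar> \<le> 2 * x\<^sup>2"
  using abs_ln_one_plus_x_minus_x_bound_nonpos[of "- x"] assms by simp

text \<open>The Laplace series differs from the logarithm of the Euler product at
  \<open>1 + \<delta>\<close> by \<open>?d\<close>. Its terms are bounded by \<open>4 / n^2\<close>
  uniformly in \<open>\<delta>\<close> and vanish one by one as \<open>\<delta>\<close> tends to 0,
  so by Tannery's theorem the transform inherits the asymptotics of
  \<open>ln (zeta (1 + \<delta>))\<close>.\<close>

interpretation primes: log_laplace "\<lambda>n. if prime n then - ln (1 - 1 / real n) else 0" "\<lambda>n. ln (real n)"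
proof
  let ?w = "\<lambda>n. if prime n then - ln (1 - 1 / real n) else 0 :: real"
  let ?e = "\<lambda>n \<delta>. exp (- \<delta> * ln (real n))"
  let ?v = "\<lambda>n \<delta>. if prime n then - ln (1 - real n powr (- (1 + \<delta>))) else 0 :: real"
  let ?d = "\<lambda>n \<delta>. ?w n * ?e n \<delta> - ?v n \<delta>"
  show "?w n \<ge> 0" for n using one_over_prime[of n] by auto
  show "ln (real n) \<ge> 0" for n by (cases "n = 0") auto
  have powr_eq: "real n powr (- (1 + \<delta>)) = (1 / real n) * ?e n \<delta>" if "prime n" for n \<delta>
  proof -
    have "real n powr (- (1 + \<delta>)) = exp (- ln (real n) + - \<delta> * ln (real n))"
      using prime_gt_0_nat[OF that] by (simp add: powr_def algebra_simps)
    then show ?thesis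
      using prime_gt_0_nat[OF that] unfolding exp_add by (simp add: exp_minus divide_inverse)
  qed
  have bound: "\<bar>?d n \<delta>\<bar> \<le> 4 * (1 / real n ^ 2)" if "\<delta> > 0" for n \<delta>
  proof (cases "prime n")
    case True
    define x e where "x = 1 / real n" and "e = ?e n \<delta>"
    have e: "0 \<le> e" "e \<le> 1" using \<open>\<delta> > 0\<close> prime_ge_1_nat[OF True] by (auto simp: e_def)
    have x: "0 \<le> x" "x \<le> 1 / 2" using one_over_prime[OF True] by (auto simp: x_def)
    have xe: "0 \<le> x * e" "x * e \<le> x" using x e by (auto simp: mult_left_le)
    \<comment> \<open>The linear terms \<open>x * e\<close> cancel, leaving two remainders of second
      order in \<open>x\<close>.\<close>
    have "?d n \<delta> = (ln (1 - x * e) + x * e) - e * (ln (1 - x) + x)"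
      unfolding powr_eq[OF True] using True by (simp add: x_def e_def algebra_simps)
    also have "\<bar>\<dots>\<bar> \<le> \<bar>ln (1 - x * e) + x * e\<bar> + e * \<bar>ln (1 - x) + x\<bar>"
      using abs_triangle_ineq4 e by (metis abs_mult abs_of_nonneg)
    also have "\<dots> \<le> 2 * (x * e)\<^sup>2 + 1 * (2 * x\<^sup>2)"
      using x xe e by (intro add_mono mult_mono abs_ln_one_minus_add_le) auto
    also have "\<dots> \<le> 2 * x\<^sup>2 + 1 * (2 * x\<^sup>2)"
      using xe by (intro add_mono mult_left_mono power_mono) auto
    finally show ?thesis by (simp add: x_def power_one_over)
  qed simp
  have sq: "summable (\<lambda>n. 4 * (1 / real n ^ 2))"
    by (intro summable_mult) (use inverse_power_summable[of 2, where 'a = real] in \<open>simp add: inverse_eq_divide\<close>)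
  have summ_d: "summable (\<lambda>n. ?d n \<delta>)" if "\<delta> > 0" for \<delta>
    by (rule summable_comparison_test'[OF sq, of 0]) (use bound[OF that] in simp)
  have euler: "(\<lambda>n. ?v n \<delta>) sums ln (zeta (1 + \<delta>))" if "\<delta> > 0" for \<delta>
    using euler_product[of "1 + \<delta>"] that by simp
  show "summable (\<lambda>n. ?w n * ?e n \<delta>)" if "\<delta> > 0" for \<delta>
    using summable_add[OF summ_d[OF that] sums_summable[OF euler[OF that]]] by simp
  have eq: "(\<Sum>n. ?w n * ?e n \<delta>) = (\<Sum>n. ?d n \<delta>) + ln (zeta (1 + \<delta>))" if "\<delta> > 0" for \<delta>
    using sums_add[OF summable_sums[OF summ_d[OF that]] euler[OF that]] by (simp add: sums_iff)
  have "((\<lambda>\<delta>. \<Sum>n. ?d n \<delta>) \<longlongrightarrow> (\<Sum>n. 0 :: real)) (at_right 0)"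
  proof (rule tannerys_theorem[THEN conjunct2, THEN conjunct2, OF _ _ sq])
    show "((\<lambda>\<delta>. ?d n \<delta>) \<longlongrightarrow> 0) (at_right 0)" for n
    proof (cases "prime n")
      case True
      then have n: "real n > 1" using prime_gt_1_nat by simp
      have "((\<lambda>\<delta>. - ln (1 - 1 / real n) * ?e n \<delta> - (- ln (1 - 1 / real n * ?e n \<delta>)))
         \<longlongrightarrow> - ln (1 - 1 / real n) * exp (- 0 * ln (real n)) - (- ln (1 - 1 / real n * exp (- 0 * ln (real n)))))
         (at_right 0)"
        using n by (intro tendsto_intros) auto
      then show ?thesis unfolding powr_eq[OF True] using True by simp
    qed simp
    show "eventually (\<lambda>(n, \<delta>). norm (?d n \<delta>) \<le> 4 * (1 / real n ^ 2)) (sequentially \<times>\<^sub>F at_right 0)"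
      unfolding eventually_prod_filter
      by (rule exI[of _ "\<lambda>_. True"], rule exI[of _ "\<lambda>\<delta>. \<delta> > 0"])
        (use bound in \<open>auto simp: eventually_at_right_less\<close>)
  qed auto
  from tendsto_add[OF this ln_zeta_asymp]
  have "((\<lambda>\<delta>. (\<Sum>n. ?d n \<delta>) + (ln (zeta (1 + \<delta>)) + ln \<delta>)) \<longlongrightarrow> 0) (at_right 0)" by simp
  moreover have "eventually (\<lambda>\<delta>. (\<Sum>n. ?d n \<delta>) + (ln (zeta (1 + \<delta>)) + ln \<delta>) =
      (\<Sum>n. ?w n * ?e n \<delta>) + ln \<delta>) (at_right 0)"
    using eventually_at_right_less[of "0::real"] by eventually_elim (simp only: eq add.assoc)
  ultimately show "((\<lambda>\<delta>. (\<Sum>n. ?w n * ?e n \<delta>) + ln \<delta>) \<longlongrightarrow> 0) (at_right 0)"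
    by (rule Lim_transform_eventually)
qed

text \<open>The logarithmic series gives the transform in closed form,
  \<open>- ln (1 - exp (- \<delta>))\<close>. Index 0 has weight \<open>1 / 0 = 0\<close>.\<close>

interpretation harmonic: log_laplace "\<lambda>n. 1 / real n" real
proof
  have series: "(\<lambda>n. 1 / real n * exp (- \<delta> * real n)) sums - ln (1 - exp (- \<delta>))" if "\<delta> > 0" for \<delta>
    using sums_minus[OF ln_series'[of "- exp (- \<delta>)"]] that
    by (simp add: exp_of_nat2_mult [symmetric] divide_inverse mult.commute)
  then show "summable (\<lambda>n. 1 / real n * exp (- \<delta> * real n))" if "\<delta> > 0" for \<delta>
    using that sums_summable by blast
  have "((\<lambda>\<delta>::real. - ln (1 - exp (- \<delta>)) + ln \<delta>) \<longlongrightarrow> 0) (at_right 0)" by real_asymp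
  moreover have "eventually (\<lambda>\<delta>. - ln (1 - exp (- \<delta>)) + ln \<delta> =
      (\<Sum>n. 1 / real n * exp (- \<delta> * real n)) + ln \<delta>) (at_right 0)"
    using eventually_at_right_less[of "0::real"]
    by eventually_elim (use series sums_unique in fastforce)
  ultimately show "((\<lambda>\<delta>. (\<Sum>n. 1 / real n * exp (- \<delta> * real n)) + ln \<delta>) \<longlongrightarrow> 0) (at_right 0)"
    by (rule Lim_transform_eventually)
qed auto

section \<open>From the harmonic numbers to Mertens' theorem\<close>

lemma harmonic_N_asymp: "((\<lambda>t. harmonic.N t - ln t) \<longlongrightarrow> euler_mascheroni) at_top"
proof -
  have N: "harmonic.N t = harm (nat \<lfloor>t\<rfloor>)" if "t > 0" for t
  proof -
    have "harmonic.N t = (\<Sum>n\<in>{1..nat \<lfloor>t\<rfloor>}. if real n \<le> t then 1 / real n else 0)"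
      unfolding harmonic.N_def
      by (rule suminf_finite) (auto simp: Suc_le_eq not_le dest: le_nat_floor)
    also have "\<dots> = harm (nat \<lfloor>t\<rfloor>)"
      unfolding harm_def using that by (intro sum.cong) (auto simp: inverse_eq_divide le_nat_iff le_floor_iff)
    finally show ?thesis .
  qed
  have fl: "filterlim (\<lambda>t::real. nat \<lfloor>t\<rfloor>) sequentially at_top"
    by (intro filterlim_compose[OF filterlim_nat_sequentially] filterlim_floor_sequentially)
  have "((\<lambda>t. (harm (nat \<lfloor>t\<rfloor>) - ln (real (nat \<lfloor>t\<rfloor>))) + (ln (real_of_int \<lfloor>t\<rfloor>) - ln t))
      \<longlongrightarrow> euler_mascheroni + 0) at_top"
    by (intro tendsto_add filterlim_compose[OF euler_mascheroni_LIMSEQ fl]) real_asymp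
  moreover have "eventually (\<lambda>t. (harm (nat \<lfloor>t\<rfloor>) - ln (real (nat \<lfloor>t\<rfloor>))) +
      (ln (real_of_int \<lfloor>t\<rfloor>) - ln t) = harmonic.N t - ln t) at_top"
    using eventually_gt_at_top[of "0::real"]
    by eventually_elim (simp add: N)
  ultimately show ?thesis by (simp add: tendsto_cong)
qed

lemma primes_N_asymp: "((\<lambda>t. primes.N t - ln t) \<longlongrightarrow> euler_mascheroni) at_top"
proof (rule order_tendstoI)
  fix a :: real assume a: "a < euler_mascheroni"
  \<comment> \<open>One \<open>\<epsilon>\<close> each is spent on the comparison error, on the
    dilation by \<open>exp \<epsilon>\<close> and on the harmonic limit. The upper half uses the
    same split with the measures exchanged.\<close>
  define \<epsilon> where "\<epsilon> = (euler_mascheroni - a) / 3"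
  have "\<epsilon> > 0" and \<gamma>: "euler_mascheroni = a + 3 * \<epsilon>" using a by (simp_all add: \<epsilon>_def field_simps)
  have "eventually (\<lambda>t. harmonic.N t \<le> primes.N (exp \<epsilon> * t) + \<epsilon>) at_top"
    by (rule N_compare[OF harmonic.log_laplace_axioms primes.log_laplace_axioms]) (use \<open>\<epsilon> > 0\<close> in auto)
  moreover have "eventually (\<lambda>t. harmonic.N t - ln t > euler_mascheroni - \<epsilon>) at_top"
    using \<open>\<epsilon> > 0\<close> by (intro order_tendstoD(1)[OF harmonic_N_asymp]) simp
  ultimately have "eventually (\<lambda>t. a < primes.N (exp \<epsilon> * t) - ln (exp \<epsilon> * t)) at_top"
    using eventually_gt_at_top[of 0]
    by eventually_elim (use \<gamma> in \<open>simp add: ln_mult_pos\<close>)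
  moreover have "filterlim (\<lambda>t. t / exp \<epsilon>) at_top at_top" by real_asymp
  ultimately have "eventually (\<lambda>t. a < primes.N (exp \<epsilon> * (t / exp \<epsilon>)) - ln (exp \<epsilon> * (t / exp \<epsilon>))) at_top"
    unfolding filterlim_iff by blast
  then show "eventually (\<lambda>t. a < primes.N t - ln t) at_top" by simp
next
  fix a :: real assume a: "a > euler_mascheroni"
  define \<epsilon> where "\<epsilon> = (a - euler_mascheroni) / 3"
  have "\<epsilon> > 0" and \<gamma>: "euler_mascheroni = a - 3 * \<epsilon>" using a by (simp_all add: \<epsilon>_def field_simps)
  have "eventually (\<lambda>t. primes.N t \<le> harmonic.N (exp \<epsilon> * t) + \<epsilon>) at_top"
    by (rule N_compare[OF primes.log_laplace_axioms harmonic.log_laplace_axioms]) (use \<open>\<epsilon> > 0\<close> in auto)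
  moreover have "filterlim (\<lambda>t. exp \<epsilon> * t) at_top at_top" by real_asymp
  then have "eventually (\<lambda>t. harmonic.N (exp \<epsilon> * t) - ln (exp \<epsilon> * t) < euler_mascheroni + \<epsilon>) at_top"
    using \<open>\<epsilon> > 0\<close> by (intro order_tendstoD(2)[OF filterlim_compose[OF harmonic_N_asymp]]) auto
  ultimately show "eventually (\<lambda>t. primes.N t - ln t < a) at_top"
    using eventually_gt_at_top[of 0]
    by eventually_elim (use \<gamma> in \<open>simp add: ln_mult_pos\<close>)
qed

theorem mertens_third:
  "((\<lambda>x. (\<Sum>p | prime p \<and> real p \<le> x. - ln (1 - 1 / real p)) - ln (ln x))
      \<longlongrightarrow> euler_mascheroni) at_top"
proof -
  \<comment> \<open>A prime \<open>p\<close> sits at \<open>ln p\<close>, so the primes up to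
    \<open>x\<close> are counted at \<open>t = ln x\<close>.\<close>
  have "((\<lambda>x. primes.N (ln x) - ln (ln x)) \<longlongrightarrow> euler_mascheroni) at_top"
    by (rule filterlim_compose[OF primes_N_asymp ln_at_top])
  moreover have "eventually (\<lambda>x. primes.N (ln x) - ln (ln x) =
      (\<Sum>p | prime p \<and> real p \<le> x. - ln (1 - 1 / real p)) - ln (ln x)) at_top"
    using eventually_gt_at_top[of 0]
  proof eventually_elim
    case (elim x)
    have "primes.N (ln x) = (\<Sum>p | prime p \<and> real p \<le> x.
        if ln (real p) \<le> ln x then if prime p then - ln (1 - 1 / real p) else 0 else 0)"
      unfolding primes.N_def using elim
      by (intro suminf_finite finite_primes_le) (auto dest: prime_gt_0_nat)
    also have "\<dots> = (\<Sum>p | prime p \<and> real p \<le> x. - ln (1 - 1 / real p))"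
      using elim by (intro sum.cong) (auto dest: prime_gt_0_nat)
    finally show ?case by simp
  qed
  ultimately show ?thesis by (simp add: tendsto_cong)
qed

section \<open>The abundancy index\<close>

definition abundancy :: "nat \<Rightarrow> real" where
  "abundancy m = real (divisor_sum m) / real m"

lemma X_eq_abundancy: "X m = abundancy m / ln (ln (real m))"
  by (simp add: X_def abundancy_def)

text \<open>Every divisor of \<open>p ^ k * m\<close> is uniquely \<open>p ^ i * d\<close> with
  \<open>i \<le> k\<close> and \<open>d dvd m\<close>.\<close>

lemma divisor_sum_prime_power_mult:
  assumes p: "prime p" and m: "m > 0" "\<not> p dvd m"
  shows "divisor_sum (p ^ k * m) = (\<Sum>i\<le>k. p ^ i) * divisor_sum m"
proof -
  let ?f = "\<lambda>(i, d). p ^ i * d"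
  have "inj_on ?f ({..k} \<times> {d. d dvd m})"
  proof (rule inj_onI, clarify)
    fix i d j e assume "d dvd m" "e dvd m" and eq: "p ^ i * d = p ^ j * e"
    then have "\<not> p dvd d" "\<not> p dvd e" using m dvd_trans by blast+
    with p eq show "i = j \<and> d = e"
      using prime_power_cancel2[of p d i e j] by (metis mult.commute)
  qed
  moreover have "?f ` ({..k} \<times> {d. d dvd m}) = {d. d dvd p ^ k * m}"
  proof (intro equalityI subsetI)
    fix d assume "d \<in> {d. d dvd p ^ k * m}"
    then obtain a b where "d = a * b" "a dvd p ^ k" "b dvd m"
      using division_decomp by blast
    moreover from this obtain i where "i \<le> k" "a = p ^ i"
      using divides_primepow_nat[OF p] by blast
    ultimately show "d \<in> ?f ` ({..k} \<times> {d. d dvd m})" by force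
  qed (auto intro!: mult_dvd_mono le_imp_power_dvd)
  ultimately have "bij_betw ?f ({..k} \<times> {d. d dvd m}) {d. d dvd p ^ k * m}"
    by (simp add: bij_betw_def)
  then have "divisor_sum (p ^ k * m) = (\<Sum>x\<in>{..k} \<times> {d. d dvd m}. ?f x)"
    unfolding divisor_sum_def by (rule sum.reindex_bij_betw [symmetric])
  also have "\<dots> = (\<Sum>i\<le>k. p ^ i) * divisor_sum m"
    unfolding divisor_sum_def by (simp add: sum_product sum.cartesian_product)
  finally show ?thesis .
qed

lemma abundancy_prime_power_mult:
  assumes p: "prime p" and m: "m > 0" "\<not> p dvd m"
  shows "abundancy (p ^ k * m) = (1 - (1 / real p) ^ Suc k) / (1 - 1 / real p) * abundancy m"
proof -
  have p1: "real p > 1" using prime_gt_1_nat[OF p] by simp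
  have "real (\<Sum>i\<le>k. p ^ i) / real (p ^ k) = (1 - (1 / real p) ^ Suc k) / (1 - 1 / real p)"
    using p1 by (simp add: sum_gp0 power_one_over divide_simps) (simp add: algebra_simps)
  then show ?thesis
    unfolding abundancy_def divisor_sum_prime_power_mult[OF assms] of_nat_mult
    by (metis times_divide_times_eq)
qed

lemma abundancy_prod_prime_powers:
  assumes "finite P" "\<And>p. p \<in> P \<Longrightarrow> prime p"
  shows "abundancy (\<Prod>p\<in>P. p ^ e p) = (\<Prod>p\<in>P. (1 - (1 / real p) ^ Suc (e p)) / (1 - 1 / real p))"
  using assms
proof (induction P rule: finite_induct)
  case empty
  then show ?case by (simp add: abundancy_def divisor_sum_def)
next
  case (insert p P)
  have "\<not> p dvd (\<Prod>q\<in>P. q ^ e q)"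
  proof
    assume "p dvd (\<Prod>q\<in>P. q ^ e q)"
    then obtain q where "q \<in> P" "p dvd q ^ e q"
      using insert by (auto simp: prime_dvd_prod_iff)
    then have "p = q" using insert.prems by (metis insertCI prime_dvd_power primes_dvd_imp_eq)
    with \<open>q \<in> P\<close> insert show False by simp
  qed
  moreover have "(\<Prod>q\<in>P. q ^ e q) > 0"
    using insert.prems by (intro prod_pos) (auto simp: prime_gt_0_nat)
  ultimately show ?case
    using insert by (simp add: abundancy_prime_power_mult del: power_Suc)
qed

text \<open>Multiplication by \<open>n\<close> injects the divisors of \<open>m\<close> into those
  of \<open>n * m\<close>. In the lower bound this absorbs the fixed factor
  \<open>n\<close>.\<close>

lemma abundancy_le_mult:
  assumes "n > 0" "m > 0"
  shows "abundancy m \<le> abundancy (n * m)"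
proof -
  have "n * divisor_sum m = (\<Sum>d\<in>(\<lambda>d. n * d) ` {d. d dvd m}. d)"
    unfolding divisor_sum_def using assms
    by (subst sum.reindex) (auto simp: inj_on_def sum_distrib_left)
  also have "\<dots> \<le> divisor_sum (n * m)"
    unfolding divisor_sum_def using assms by (intro sum_mono2) auto
  finally have "real n * real (divisor_sum m) \<le> real (divisor_sum (n * m))"
    by (metis of_nat_le_iff of_nat_mult)
  then show ?thesis using assms by (simp add: abundancy_def field_simps)
qed

section \<open>The upper bound\<close>

lemma ln_abundancy_le:
  assumes "real m > exp 1"
  shows "ln (abundancy m) \<le>
    (\<Sum>p | prime p \<and> real p \<le> ln (real m). - ln (1 - 1 / real p)) + 2 / ln (ln (real m))"
proof -
  define L where "L = ln (real m)"
  define P where "P = prime_factors m"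
  define Q where "Q = {p \<in> P. real p > L}"
  let ?w = "\<lambda>p::nat. - ln (1 - 1 / real p)"
  have "real m > 0" using assms exp_gt_zero[of 1] by linarith
  then have m: "m > 0" by simp
  have L: "L > 1" unfolding L_def using assms \<open>real m > 0\<close> by (metis exp_less_cancel_iff exp_ln)
  have P: "finite P" "\<And>p. p \<in> P \<Longrightarrow> prime p" by (auto simp: P_def)
  have m_eq: "m = (\<Prod>p\<in>P. p ^ multiplicity p m)"
    unfolding P_def by (rule prime_factorization_nat[OF m])
  have w_nonneg: "?w p \<ge> 0" if "prime p" for p
    using one_over_prime[OF that] by auto
  have "abundancy m = (\<Prod>p\<in>P. (1 - (1 / real p) ^ Suc (multiplicity p m)) / (1 - 1 / real p))"
    using abundancy_prod_prime_powers[OF P, of "\<lambda>p. multiplicity p m"] m_eq by simp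
  also have "\<dots> \<le> (\<Prod>p\<in>P. exp (?w p))"
  proof (rule prod_mono)
    fix p assume "p \<in> P"
    then have p: "0 < 1 / real p" "1 / real p \<le> 1 / 2" using one_over_prime[of p] P(2) by blast+
    have "exp (?w p) = 1 / (1 - 1 / real p)"
      using p by (simp add: exp_minus inverse_eq_divide)
    moreover have "0 \<le> (1 / real p) ^ k" "(1 / real p) ^ k \<le> 1" for k
      using p by (auto intro!: power_le_one)
    ultimately show "0 \<le> (1 - (1 / real p) ^ Suc (multiplicity p m)) / (1 - 1 / real p) \<and>
        (1 - (1 / real p) ^ Suc (multiplicity p m)) / (1 - 1 / real p) \<le> exp (?w p)"
      using p by (auto intro!: divide_nonneg_nonneg divide_right_mono simp del: power_Suc)
  qed
  also have "\<dots> = exp (\<Sum>p\<in>P. ?w p)" using P by (simp add: exp_sum)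
  finally have le: "abundancy m \<le> exp (\<Sum>p\<in>P. ?w p)" .
  have "divisor_sum m > 0"
    unfolding divisor_sum_def using m by (intro sum_pos2[of _ 1]) auto
  then have "abundancy m > 0" using m by (simp add: abundancy_def)
  with le have "ln (abundancy m) \<le> (\<Sum>p\<in>P. ?w p)"
    by (metis exp_gt_zero ln_exp ln_le_cancel_iff)
  also have "\<dots> = (\<Sum>p\<in>P - Q. ?w p) + (\<Sum>p\<in>Q. ?w p)"
    using P by (intro sum.subset_diff) (auto simp: Q_def)
  also have "(\<Sum>p\<in>P - Q. ?w p) \<le> (\<Sum>p | prime p \<and> real p \<le> L. ?w p)"
    using P by (intro sum_mono2 finite_primes_le w_nonneg) (auto simp: Q_def)
  also have "(\<Sum>p\<in>Q. ?w p) \<le> real (card Q) * (2 / L)"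
  proof (rule sum_bounded_above)
    fix p assume "p \<in> Q"
    then have "prime p" "real p > L" using P by (auto simp: Q_def)
    note p = one_over_prime[OF \<open>prime p\<close>]
    have "?w p \<le> 1 / real p + 2 * (1 / real p)\<^sup>2"
      using abs_ln_one_minus_add_le[of "1 / real p"] p by auto
    \<comment> \<open>One factor of the square is replaced by \<open>1 / 2\<close>, so the quadratic
      term costs only a second \<open>1 / p\<close>.\<close>
    also have "\<dots> \<le> 1 / real p + 2 * (1 / 2 * (1 / real p))"
      unfolding power2_eq_square using p by (intro add_left_mono mult_left_mono mult_right_mono) auto
    also have "\<dots> \<le> 2 / L" using \<open>real p > L\<close> L by (simp add: frac_le)
    finally show "?w p \<le> 2 / L" .
  qed
  also have "real (card Q) * (2 / L) \<le> 2 / ln L"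
  proof -
    \<comment> \<open>The primes in \<open>Q\<close> exceed \<open>L\<close> and their product is at
      most \<open>m\<close>; taking logarithms of \<open>L ^ card Q \<le> m\<close> bounds their
      number by \<open>L / ln L\<close>.\<close>
    have "L ^ card Q = (\<Prod>p\<in>Q. L)" by simp
    also have "\<dots> \<le> (\<Prod>p\<in>Q. real (p ^ multiplicity p m))"
    proof (rule prod_mono)
      fix p assume "p \<in> Q"
      then have "prime p" "real p > L" "multiplicity p m > 0"
        by (auto simp: Q_def P_def prime_factors_multiplicity)
      then have "p \<le> p ^ multiplicity p m"
        by (intro self_le_power prime_ge_1_nat)
      then have "real p \<le> real (p ^ multiplicity p m)" by (rule of_nat_mono)
      then show "0 \<le> L \<and> L \<le> real (p ^ multiplicity p m)" using L \<open>real p > L\<close> by linarith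
    qed
    also have "\<dots> \<le> (\<Prod>p\<in>P. real (p ^ multiplicity p m))"
      using P by (intro prod_mono2) (auto simp: Q_def Suc_le_eq prime_gt_0_nat)
    also have "\<dots> = real m" by (metis m_eq of_nat_prod)
    finally have "L ^ card Q \<le> real m" .
    moreover have "L ^ card Q > 0" using L by simp
    ultimately have "ln (L ^ card Q) \<le> ln (real m)" by (rule ln_mono)
    then have "ln (L ^ card Q) \<le> L" by (simp only: L_def)
    then have "real (card Q) * ln L \<le> L" using L by (simp add: ln_realpow)
    then show ?thesis using L by (simp add: field_simps)
  qed
  finally show ?thesis unfolding L_def by simp
qed

lemma eventually_X_less:
  assumes "y > exp euler_mascheroni"
  shows "eventually (\<lambda>m. X m < y) sequentially"
proof -
  let ?M = "\<lambda>x. \<Sum>p | prime p \<and> real p \<le> x. - ln (1 - 1 / real p)"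
  \<comment> \<open>The bound for \<open>abundancy m\<close> divided by \<open>ln (ln m)\<close>,
    with the divisor moved into the exponent so that Mertens' theorem applies at
    \<open>x = ln m\<close>.\<close>
  let ?g = "\<lambda>m. exp ((?M (ln (real m)) - ln (ln (ln (real m)))) + 2 / ln (ln (real m)))"
  have "filterlim (\<lambda>m. ln (real m)) at_top sequentially" by real_asymp
  note lim = filterlim_compose[OF mertens_third this]
  have "?g \<longlonglongrightarrow> exp (euler_mascheroni + 0)"
    by (intro tendsto_exp tendsto_add lim) real_asymp
  then have "eventually (\<lambda>m. ?g m < y) sequentially"
    using assms by (intro order_tendstoD(2)) auto
  moreover have "eventually (\<lambda>m. real m > exp 1) sequentially" by real_asymp
  moreover have "eventually (\<lambda>m. ln (ln (real m)) > 0) sequentially" by real_asymp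
  ultimately show ?thesis
  proof eventually_elim
    case (elim m)
    have "abundancy m \<le> exp (ln (abundancy m))"
      by (cases "abundancy m > 0") (auto simp: not_less intro: order_trans)
    also have "\<dots> \<le> exp (?M (ln (real m)) + 2 / ln (ln (real m)))"
      using ln_abundancy_le[OF elim(2)] by simp
    also have "\<dots> = ?g m * ln (ln (real m))"
      using elim(3) by (simp add: exp_add exp_diff)
    finally have "X m \<le> ?g m"
      using elim(3) by (simp add: X_eq_abundancy pos_divide_le_eq)
    with elim(1) show ?case by linarith
  qed
qed

section \<open>Test numbers for the lower bound\<close>

definition test_number :: "nat \<Rightarrow> nat" where
  "test_number r = (\<Prod>p | prime p \<and> real p \<le> 2 ^ r. p ^ (2 * r))"

lemma primes_le_subset: "{p. prime p \<and> real p \<le> 2 ^ r} \<subseteq> {1..2 ^ r}"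
  by (auto simp: prime_ge_1_nat Suc_le_eq prime_gt_0_nat)

lemma card_primes_le: "card {p. prime p \<and> real p \<le> 2 ^ r} \<le> 2 ^ r"
  using card_mono[OF _ primes_le_subset[of r]] by simp

lemma test_number_pos: "test_number r > 0"
  unfolding test_number_def by (intro prod_pos) (auto simp: prime_gt_0_nat)

text \<open>The prime 2 alone contributes this factor.\<close>

lemma test_number_ge:
  assumes "r > 0"
  shows "2 ^ (2 * r) \<le> test_number r"
proof -
  have "(2 :: nat) ^ 1 \<le> 2 ^ r" using assms by (intro power_increasing) auto
  then have "2 \<in> {p. prime p \<and> real p \<le> 2 ^ r}" by simp
  then have "2 ^ (2 * r) dvd test_number r"
    unfolding test_number_def by (intro dvd_prodI finite_primes_le)
  then show ?thesis using test_number_pos dvd_imp_le by blast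
qed

lemma ln_test_number_le: "ln (real (test_number r)) \<le> 2 ^ r * (2 * real r * (real r * ln 2))"
proof -
  let ?P = "{p. prime p \<and> real p \<le> 2 ^ r}"
  have "ln (real (test_number r)) = (\<Sum>p\<in>?P. ln (real (p ^ (2 * r))))"
    unfolding test_number_def of_nat_prod
    by (intro ln_prod finite_primes_le) (auto simp: prime_gt_0_nat)
  also have "\<dots> \<le> real (card ?P) * (2 * real r * (real r * ln 2))"
  proof (rule sum_bounded_above)
    fix p assume p: "p \<in> ?P"
    then have "ln (real p) \<le> ln (2 ^ r)" by (subst ln_le_cancel_iff) (auto simp: prime_gt_0_nat)
    then have "ln (real p) \<le> real r * ln 2" by (simp add: ln_realpow)
    then show "ln (real (p ^ (2 * r))) \<le> 2 * real r * (real r * ln 2)"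
      using p by (simp add: ln_realpow prime_gt_0_nat mult_left_mono)
  qed
  also have "\<dots> \<le> 2 ^ r * (2 * real r * (real r * ln 2))"
    using of_nat_mono[OF card_primes_le[of r], where 'a = real] by (intro mult_right_mono) auto
  finally show ?thesis .
qed

text \<open>Truncating the geometric sum at \<open>p\<close> costs a factor \<open>1 - ?q p\<close>.
  By the Weierstrass product inequality the total loss is at most the sum of the
  \<open>?q p\<close>, that is at most \<open>2 ^ r\<close> terms of size
  \<open>(1 / 2) ^ (2 * r + 1)\<close>.\<close>

lemma abundancy_test_number_ge:
  "exp (\<Sum>p | prime p \<and> real p \<le> 2 ^ r. - ln (1 - 1 / real p)) * (1 - (1 / 2) ^ r)
    \<le> abundancy (test_number r)"
proof -
  let ?P = "{p. prime p \<and> real p \<le> 2 ^ r}"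
  let ?q = "\<lambda>p::nat. (1 / real p) ^ Suc (2 * r)"
  have q: "0 \<le> ?q p" "?q p \<le> (1 / 2) ^ Suc (2 * r)" if "p \<in> ?P" for p
    using one_over_prime[of p] that by (auto intro!: power_mono simp del: power_Suc)
  have half: "(1 / 2 :: real) ^ Suc (2 * r) \<le> 1" by (intro power_le_one) auto
  have "(\<Sum>p\<in>?P. ?q p) \<le> real (card ?P) * (1 / 2) ^ Suc (2 * r)"
    by (intro sum_bounded_above q)
  also have "\<dots> \<le> 2 ^ r * (1 / 2) ^ Suc (2 * r)"
    using of_nat_mono[OF card_primes_le[of r], where 'a = real] by (intro mult_right_mono) auto
  also have "\<dots> \<le> (1 / 2) ^ r"
    by (simp add: power_mult power2_eq_square power_mult_distrib field_simps)
  finally have "1 - (1 / 2) ^ r \<le> 1 - (\<Sum>p\<in>?P. ?q p)" by simp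
  also have "\<dots> \<le> (\<Prod>p\<in>?P. 1 - ?q p)"
    using order_trans[OF q(2) half] q(1)
    by (intro Weierstrass_prod_ineq) (simp del: power_Suc)
  finally have "exp (\<Sum>p\<in>?P. - ln (1 - 1 / real p)) * (1 - (1 / 2) ^ r)
      \<le> exp (\<Sum>p\<in>?P. - ln (1 - 1 / real p)) * (\<Prod>p\<in>?P. 1 - ?q p)"
    by (intro mult_left_mono) auto
  also have "\<dots> = (\<Prod>p\<in>?P. exp (- ln (1 - 1 / real p)) * (1 - ?q p))"
    by (simp add: exp_sum finite_primes_le prod.distrib)
  also have "\<dots> = (\<Prod>p\<in>?P. (1 - ?q p) / (1 - 1 / real p))"
  proof (rule prod.cong[OF refl])
    fix p assume "p \<in> ?P"
    then have "1 - 1 / real p > 0" using one_over_prime[of p] by auto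
    then show "exp (- ln (1 - 1 / real p)) * (1 - ?q p) = (1 - ?q p) / (1 - 1 / real p)"
      by (simp add: exp_minus divide_inverse mult.commute)
  qed
  also have "\<dots> = abundancy (test_number r)"
    unfolding test_number_def
    by (rule abundancy_prod_prime_powers [symmetric]) (auto simp: finite_primes_le)
  finally show ?thesis .
qed

theorem theorem4:
  fixes n :: nat
  assumes "n > 0"
  shows "limsup (\<lambda>x::nat. ereal (X (n * x))) = ereal (exp euler_mascheroni)"
proof (rule antisym)
  show "limsup (\<lambda>x. ereal (X (n * x))) \<le> ereal (exp euler_mascheroni)"
    unfolding Limsup_le_iff
  proof (intro allI impI)
    fix y assume y: "ereal (exp euler_mascheroni) < y"
    have mult: "filterlim (\<lambda>x. n * x) sequentially sequentially"
      using assms by (rule mult_nat_left_at_top)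
    show "eventually (\<lambda>x. ereal (X (n * x)) < y) sequentially"
    proof (cases y)
      case (real z)
      with y have "eventually (\<lambda>m. X m < z) sequentially" by (intro eventually_X_less) simp
      with mult have "eventually (\<lambda>x. X (n * x) < z) sequentially"
        unfolding filterlim_iff by blast
      with real show ?thesis by simp
    qed (use y in auto)
  qed
next
  let ?M = "\<lambda>x. \<Sum>p | prime p \<and> real p \<le> x. - ln (1 - 1 / real p)"
  \<comment> \<open>An upper bound for \<open>ln (n * test_number r)\<close>. Its logarithm is
    \<open>r * ln 2 + O(ln r)\<close>, so the last quotient in \<open>?g\<close> tends to 1.\<close>
  let ?D = "\<lambda>r. ln (real n) + 2 ^ r * (2 * real r * (real r * ln 2))"
  let ?g = "\<lambda>r. exp (?M (2 ^ r) - ln (ln (2 ^ r))) * (1 - (1 / 2) ^ r) * (ln (2 ^ r) / ln (?D r))"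
  have "filterlim (\<lambda>r. (2 :: real) ^ r) at_top sequentially" by real_asymp
  note lim = filterlim_compose[OF mertens_third this]
  have "?g \<longlonglongrightarrow> exp euler_mascheroni * 1 * 1"
    by (intro tendsto_mult tendsto_exp lim) real_asymp+
  then have g_lim: "(\<lambda>r. ereal (?g r)) \<longlonglongrightarrow> ereal (exp euler_mascheroni)" by simp
  have le: "eventually (\<lambda>r. ?g r \<le> X (n * test_number r)) sequentially"
    using eventually_gt_at_top[of 1]
  proof eventually_elim
    case (elim r)
    let ?m = "n * test_number r"
    \<comment> \<open>As \<open>r\<close> is at least 2, the argument of \<open>X\<close> is at
      least 16 and so exceeds \<open>exp 1\<close>; this makes the iterated logarithm
      positive.\<close>
    have "(2 :: nat) ^ 4 \<le> 2 ^ (2 * r)" using elim by (intro power_increasing) auto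
    also have "\<dots> \<le> test_number r" using elim by (intro test_number_ge) simp
    also have "\<dots> \<le> ?m" using assms by simp
    finally have "real ?m \<ge> real (2 ^ 4)" by (rule of_nat_mono)
    then have "exp 1 < real ?m" using exp_le by simp
    then have m: "ln (real ?m) > 1" by (metis exp_gt_zero exp_less_cancel_iff exp_ln less_trans)
    have D: "ln (real ?m) \<le> ?D r"
      using assms test_number_pos[of r] ln_test_number_le[of r] by (simp add: ln_mult_pos)
    have "exp (?M (2 ^ r)) * (1 - (1 / 2) ^ r) \<le> abundancy ?m"
      using abundancy_test_number_ge[of r] abundancy_le_mult[OF assms test_number_pos[of r]] by linarith
    moreover have "exp (?M (2 ^ r)) * (1 - (1 / 2) ^ r) \<ge> 0" by (simp add: power_le_one)
    moreover have "0 < ln (ln (real ?m))" "ln (ln (real ?m)) \<le> ln (?D r)"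
      using m D by auto
    ultimately have "exp (?M (2 ^ r)) * (1 - (1 / 2) ^ r) / ln (?D r) \<le> abundancy ?m / ln (ln (real ?m))"
      by (intro frac_le) auto
    moreover have "ln (2 ^ r) > (0 :: real)" using elim by (simp add: ln_realpow)
    then have "?g r = exp (?M (2 ^ r)) * (1 - (1 / 2) ^ r) / ln (?D r)"
      by (simp add: exp_diff)
    ultimately show ?case by (simp only: X_eq_abundancy)
  qed
  have test_at_top: "filterlim test_number sequentially sequentially"
  proof (rule filterlim_at_top_mono)
    show "filterlim (\<lambda>r::nat. r) at_top sequentially" by (rule filterlim_ident)
    show "eventually (\<lambda>r. r \<le> test_number r) sequentially"
      using eventually_gt_at_top[of 0]
    proof eventually_elim
      case (elim r)
      have "r \<le> 2 * r" by simp
      also have "\<dots> \<le> 2 ^ (2 * r)" using less_exp[of "2 * r"] by simp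
      also have "\<dots> \<le> test_number r" using elim by (rule test_number_ge)
      finally show ?case .
    qed
  qed
  show "ereal (exp euler_mascheroni) \<le> limsup (\<lambda>x. ereal (X (n * x)))"
  proof (rule ccontr)
    assume "\<not> ?thesis"
    \<comment> \<open>Along the test numbers \<open>X\<close> would eventually lie below
      \<open>z\<close>, while its lower bound \<open>?g\<close> eventually lies above
      \<open>z\<close>.\<close>
    then obtain z where z: "limsup (\<lambda>x. ereal (X (n * x))) < z" "z < ereal (exp euler_mascheroni)"
      using dense not_le by metis
    have "eventually (\<lambda>x. ereal (X (n * x)) < z) sequentially"
      using z(1) by (rule Limsup_lessD)
    with test_at_top have "eventually (\<lambda>r. ereal (X (n * test_number r)) < z) sequentially"
      unfolding filterlim_iff by blast
    moreover have "eventually (\<lambda>r. z < ereal (?g r)) sequentially"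
      using g_lim z(2) by (rule order_tendstoD(1))
    ultimately have "eventually (\<lambda>r. False) sequentially"
      using le
    proof eventually_elim
      case (elim r)
      then have "ereal (?g r) \<le> ereal (X (n * test_number r))" by simp
      with elim(1,2) show ?case by (meson leD less_trans)
    qed
    then show False by simp
  qed
qed

end
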